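(* Let $N$ be an ordered negative support family for $\mathbf v_0$, and let $P_{N,I_{\mathbf 0}}=\langle(B\mathbf s)^{J\setminus I_{\mathbf 0}}\mid J\in N^c\rangle\subset\mathbb C[[\mathbf s]]$. Assume that $$P_N:m_N(\mathbf s)=P_{N,I_{\mathbf 0}}.$$ Then $$\Phi(\widehat Q_N:\widehat m_N(\mathbf t))=P_N:m_N(\mathbf s).$$
   Context: $\mathbb N$ is the set of nonnegative integers. Let $A=(\mathbf a_1,\dots,\mathbf a_n)=(a_{ij})$ be a $d\times n$ integer matrix of rank $d$ whose columns all lie in a single affine hyperplane of $\mathbb Q^d$ not passing through the origin. Put $L=\operatorname{Ker}_{\mathbb Z}(A)\subset\mathbb Z^n$ and $L_{\mathbb C}=\operatorname{Ker}_{\mathbb C}(A)$. The toric ideal is $I_A=\langle\partial_{\mathbf x}^{\mathbf u}-\partial_{\mathbf x}^{\mathbf v}\mid A\mathbf u=A\mathbf v,\ \mathbf u,\mathbf v\in\mathbb N^n\rangle\subset\mathbb C[\partial_1,\dots,\partial_n]$. For $\boldsymbol\beta\in\mathbb C^d$, $H_A(\boldsymbol\beta)$ is the left ideal of the Weyl algebra $D$ in $x_j,\partial_j$ generated by $I_A$ and the operators $\sum_j a_{ij}\theta_j-\beta_i$ ($1\le i\le d$), $\theta_j=x_j\partial_j$. Fix a generic weight $\mathbf w\in\mathbb R^n$, i.e. such that $\operatorname{in}_{\mathbf w}(I_A)$ (generated by the parts of maximal $\mathbf w$-weight of elements of $I_A$) is a monomial ideal, and a fake exponent $\mathbf v_0\in\mathbb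 C^n$ of $H_A(\boldsymbol\beta)$ with respect to $\mathbf w$, i.e. a zero of $(D\operatorname{in}_{\mathbf w}(I_A)\cap\mathbb C[\boldsymbol\theta])+\langle A\boldsymbol\theta-\boldsymbol\beta\rangle\subset\mathbb C[\boldsymbol\theta]$. For $\mathbf u\in L$ put $I_{\mathbf u}=\{j\mid(\mathbf v_0+\mathbf u)_j\in\mathbb Z_{<0}\}$; put $\mathrm{NS}=\{I_{\mathbf u}\mid\mathbf u\in L\}$ and $\mathcal N_{\mathbf v_0}=\{I\in\mathrm{NS}\mid \mathbf w\cdot\mathbf u\ge0\text{ for every }\mathbf u\in L\text{ with }I_{\mathbf u}=I\}$. A negative support family for $\mathbf v_0$ is a set $N$ with $I_{\mathbf 0}\in N\subset\mathcal N_{\mathbf v_0}$; it is ordered if $I\in N$, $J\in\mathrm{NS}$, $J\subset I$ imply $J\in N$. Put $N^c=\mathrm{NS}\setminus N$ and $K_N=\bigcap_{I\in N}I$. Ambient side: $\mathbf t=(t_1,\dots,t_n)$, $\mathbf t^S=\prod_{j\in S}t_j$ (empty product $=1$). In $\mathbb C[[\mathbf t]]$ put $\widehat m_N(\mathbf t)=\mathbf t^{I_{\mathbf 0}\setminus K_N}$, $\widehat M_N=\langle\mathbf t^{I\setminus K_N}\mid I\in N\rangle$, $\widehat P_N=\langle\mathbf t^{(I\cup J)\setminus K_N}\mid I\in N,J\in N^c\rangle$, $\langle A\mathbf t\rangle=\langle\sum_j a_{ij}t_j\mid1\le i\le d\rangle$, $\widehat Q_N=\langle A\mathbf t\rangle\widehat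 M_N+\widehat P_N$. Intrinsic side: fix a basis $\mathbf b^{(1)},\dots,\mathbf b^{(n-d)}$ of $L_{\mathbb C}$, also viewed as the matrix $B$ with these columns; $\mathbf s=(s_1,\dots,s_{n-d})$, $(B\mathbf s)_j=\sum_k b^{(k)}_j s_k$, $(B\mathbf s)^S=\prod_{j\in S}(B\mathbf s)_j$. In $\mathbb C[[\mathbf s]]$ put $m_N(\mathbf s)=(B\mathbf s)^{I_{\mathbf 0}\setminus K_N}$ and $P_N=\langle(B\mathbf s)^{(I\cup J)\setminus K_N}\mid I\in N,J\in N^c\rangle$. $\Phi:\mathbb C[[\mathbf t]]\to\mathbb C[[\mathbf s]]$ is the $\mathbb C$-algebra homomorphism $f\mapsto f((B\mathbf s)_1,\dots,(B\mathbf s)_n)$. $J:m=\{f\mid fm\in J\}$ (formed in the respective power series ring). *)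

theory Defs
  imports "HOL-Analysis.Analysis" "HOL-Library.Poly_Mapping"
begin

section \<open>Ideals in a subring of a type-class ring\<close>

text \<open>
  \<open>R\<close> is (the carrier of) a unital subring of the ambient ring and \<open>G \<subseteq> R\<close>; the result is the
  left ideal of \<open>R\<close> generated by \<open>G\<close>, i.e. the ideal if \<open>R\<close> is commutative.
\<close>

definition left_ideal_gen :: "'a::ring_1 set \<Rightarrow> 'a set \<Rightarrow> 'a set" where
  "left_ideal_gen R G = {\<Sum>g\<in>F. c g * g | F c. finite F \<and> F \<subseteq> G \<and> (\<forall>g\<in>F. c g \<in> R)}"

definition ideal_sum :: "'a::ring_1 set \<Rightarrow> 'a set \<Rightarrow> 'a set" where
  "ideal_sum I J = {f + g | f g. f \<in> I \<and> g \<in> J}"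

definition ideal_prod :: "'a::comm_ring_1 set \<Rightarrow> 'a set \<Rightarrow> 'a set \<Rightarrow> 'a set" where
  "ideal_prod R I J = left_ideal_gen R {f * g | f g. f \<in> I \<and> g \<in> J}"

definition ideal_colon :: "'a::comm_ring_1 set \<Rightarrow> 'a set \<Rightarrow> 'a \<Rightarrow> 'a set" where
  "ideal_colon R J m = {f \<in> R. f * m \<in> J}"


section \<open>Formal power series in several variables\<close>

text \<open>
  The variables are the elements of the type \<open>'v\<close>, which may be infinite: every monomial has only
  finitely many factorizations, so the Cauchy product is always defined.
\<close>

typedef 'v mps = "UNIV :: (('v \<Rightarrow>\<^sub>0 nat) \<Rightarrow> complex) set"
  morphisms mps_coeff Abs_mps ..

setup_lifting type_definition_mps

lemma mps_eqI: "(\<And>e. mps_coeff f e = mps_coeff g e) \<Longrightarrow> f = g"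
  by (simp add: mps_coeff_inject[symmetric] fun_eq_iff)

lemma finite_exponent_splits: "finite {(a, b). a + b = (e :: 'v \<Rightarrow>\<^sub>0 nat)}"
proof -
  let ?M = "Max (Poly_Mapping.lookup e ` Poly_Mapping.keys e)"
  let ?F = "{f. \<forall>x. (x \<in> Poly_Mapping.keys e \<longrightarrow> f x \<in> {..?M}) \<and>
    (x \<notin> Poly_Mapping.keys e \<longrightarrow> f x = (0::nat))}"
  have "Poly_Mapping.lookup a \<in> ?F" if "a + b = e" for a b
  proof -
    have le: "Poly_Mapping.lookup a x \<le> Poly_Mapping.lookup e x" for x
      using that by (metis le_add1 lookup_add)
    show ?thesis
      using le by (auto simp: in_keys_iff intro!: order_trans[OF le] Max_ge)
         (metis le le_zero_eq)
  qed
  then have "Poly_Mapping.lookup ` {a. \<exists>b. a + b = e} \<subseteq> ?F"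
    by (intro image_subsetI) (elim CollectE exE)
  moreover have "finite ?F"
    by (rule finite_set_of_finite_funs) auto
  ultimately have "finite (Poly_Mapping.lookup ` {a. \<exists>b. a + b = e})"
    by (rule finite_subset)
  then have fin: "finite {a. \<exists>b. a + b = e}"
    by (rule finite_imageD) (auto simp: inj_on_def lookup_inject)
  have "{(a, b). a + b = e} \<subseteq> (\<lambda>a. (a, e - a)) ` {a. \<exists>b. a + b = e}"
    by auto
  with fin show ?thesis by (meson finite_imageI finite_subset)
qed

instantiation mps :: (type) comm_ring_1
begin

lift_definition zero_mps :: "'a mps" is "\<lambda>_. 0" .
lift_definition one_mps :: "'a mps" is "\<lambda>e. if e = 0 then 1 else 0" .
lift_definition plus_mps :: "'a mps \<Rightarrow> 'a mps \<Rightarrow> 'a mps" is "\<lambda>f g e. f e + g e" .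
lift_definition minus_mps :: "'a mps \<Rightarrow> 'a mps \<Rightarrow> 'a mps" is "\<lambda>f g e. f e - g e" .
lift_definition uminus_mps :: "'a mps \<Rightarrow> 'a mps" is "\<lambda>f e. - f e" .
lift_definition times_mps :: "'a mps \<Rightarrow> 'a mps \<Rightarrow> 'a mps"
  is "\<lambda>f g e. \<Sum>(a, b)\<in>{(a, b). a + b = e}. f a * g b" .

instance
proof
  fix f g h :: "'a mps"
  show "f * g * h = f * (g * h)"
  proof (rule mps_eqI)
    fix e
    have "mps_coeff (f * g * h) e =
        (\<Sum>p\<in>{(p, c). p + c = e}. \<Sum>q\<in>{(a, b). a + b = fst p}.
          mps_coeff f (fst q) * mps_coeff g (snd q) * mps_coeff h (snd p))"
      by (simp add: times_mps.rep_eq sum_distrib_right case_prod_unfold)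
    also have "\<dots> = (\<Sum>(p, q)\<in>Sigma {(p, c). p + c = e} (\<lambda>p. {(a, b). a + b = fst p}).
          mps_coeff f (fst q) * mps_coeff g (snd q) * mps_coeff h (snd p))"
      by (rule sum.Sigma) (use finite_exponent_splits in auto)
    also have "\<dots> = (\<Sum>(p, q)\<in>Sigma {(a, p). a + p = e} (\<lambda>p. {(b, c). b + c = snd p}).
          mps_coeff f (fst p) * (mps_coeff g (fst q) * mps_coeff h (snd q)))"
      by (rule sum.reindex_bij_witness[
            where i = "\<lambda>((a, p), (b, c)). ((a + b, c), (a, b))"
              and j = "\<lambda>((p, c), (a, b)). ((a, b + c), (b, c))"])
         (auto simp: algebra_simps)
    also have "\<dots> = (\<Sum>p\<in>{(a, p). a + p = e}. \<Sum>q\<in>{(b, c). b + c = snd p}.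
          mps_coeff f (fst p) * (mps_coeff g (fst q) * mps_coeff h (snd q)))"
      by (rule sum.Sigma[symmetric]) (use finite_exponent_splits in auto)
    also have "\<dots> = mps_coeff (f * (g * h)) e"
      by (simp add: times_mps.rep_eq sum_distrib_left case_prod_unfold)
    finally show "mps_coeff (f * g * h) e = mps_coeff (f * (g * h)) e" .
  qed
  show "f * g = g * f"
  proof (rule mps_eqI)
    fix e
    show "mps_coeff (f * g) e = mps_coeff (g * f) e"
      unfolding times_mps.rep_eq
      by (rule sum.reindex_bij_witness[where i = prod.swap and j = prod.swap])
         (auto simp: algebra_simps)
  qed
  show "1 * f = f"
  proof (rule mps_eqI)
    fix e
    have "mps_coeff (1 * f) e = (\<Sum>(a, b)\<in>{(a, b). a + b = e}. if (a, b) = (0, e) then mps_coeff f e else 0)"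
      unfolding times_mps.rep_eq one_mps.rep_eq
      by (rule sum.cong) auto
    also have "\<dots> = mps_coeff f e"
      using sum.delta[OF finite_exponent_splits[of e], of "(0, e)" "\<lambda>_. mps_coeff f e"]
      by (simp add: case_prod_unfold prod_eq_iff)
    finally show "mps_coeff (1 * f) e = mps_coeff f e" .
  qed
  show "(f + g) * h = f * h + g * h"
    by (rule mps_eqI)
       (simp add: times_mps.rep_eq plus_mps.rep_eq case_prod_unfold sum.distrib algebra_simps)
  show "(0::'a mps) \<noteq> 1"
    by transfer (metis zero_neq_one)
qed (transfer; simp add: fun_eq_iff algebra_simps)+

end

lift_definition mps_const :: "complex \<Rightarrow> 'v mps" is "\<lambda>c e. if e = 0 then c else 0" .

lift_definition mps_var :: "'v \<Rightarrow> 'v mps" is "\<lambda>j e. if e = Poly_Mapping.single j 1 then 1 else 0" .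

definition mps_ring :: "'v set \<Rightarrow> 'v mps set" where
  "mps_ring V = {f. \<forall>e. mps_coeff f e \<noteq> 0 \<longrightarrow> Poly_Mapping.keys e \<subseteq> V}"

text \<open>
  Substitution of \<open>g j\<close> for the variable \<open>j\<close> in \<open>f\<close>. If there are finitely many variables and no
  \<open>g j\<close> has a constant term, then the index set of the sum is finite.
\<close>

lift_definition mps_subst :: "('v \<Rightarrow> 'k mps) \<Rightarrow> 'v mps \<Rightarrow> 'k mps" is
  "\<lambda>g f e. \<Sum>u | mps_coeff (\<Prod>j\<in>Poly_Mapping.keys u. g j ^ Poly_Mapping.lookup u j) e \<noteq> 0.
     mps_coeff f u * mps_coeff (\<Prod>j\<in>Poly_Mapping.keys u. g j ^ Poly_Mapping.lookup u j) e" .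


section \<open>Polynomials and the Weyl algebra\<close>

type_synonym 'v cpoly = "('v \<Rightarrow>\<^sub>0 nat) \<Rightarrow>\<^sub>0 complex"

definition cpoly_const :: "complex \<Rightarrow> 'v cpoly" where
  "cpoly_const c = Poly_Mapping.single 0 c"

definition cpoly_var :: "'v \<Rightarrow> 'v cpoly" where
  "cpoly_var j = Poly_Mapping.single (Poly_Mapping.single j 1) 1"

definition cpoly_eval :: "('v \<Rightarrow> complex) \<Rightarrow> 'v cpoly \<Rightarrow> complex" where
  "cpoly_eval z p = (\<Sum>e\<in>Poly_Mapping.keys p.
    Poly_Mapping.lookup p e * (\<Prod>j\<in>Poly_Mapping.keys e. z j ^ Poly_Mapping.lookup e j))"

definition cpoly_pderiv :: "'v \<Rightarrow> 'v cpoly \<Rightarrow> 'v cpoly" where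
  "cpoly_pderiv j p =
    (\<Sum>e\<in>Poly_Mapping.keys p. Poly_Mapping.single (e - Poly_Mapping.single j 1)
      (of_nat (Poly_Mapping.lookup e j) * Poly_Mapping.lookup p e))"

text \<open>
  The Weyl algebra, as the algebra of linear operators on polynomials generated by the
  multiplications by the variables and the partial derivatives (a faithful representation, the
  ground field having characteristic 0).
\<close>

inductive_set weyl_ops :: "('v cpoly \<Rightarrow> 'v cpoly) set" where
  const: "(\<lambda>p. cpoly_const c * p) \<in> weyl_ops"
| var: "(\<lambda>p. cpoly_var j * p) \<in> weyl_ops"
| pderiv: "cpoly_pderiv j \<in> weyl_ops"
| add: "P \<in> weyl_ops \<Longrightarrow> Q \<in> weyl_ops \<Longrightarrow> (\<lambda>p. P p + Q p) \<in> weyl_ops"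
| comp: "P \<in> weyl_ops \<Longrightarrow> Q \<in> weyl_ops \<Longrightarrow> (\<lambda>p. P (Q p)) \<in> weyl_ops"

lemma cpoly_pderiv_superset:
  assumes "finite S" "Poly_Mapping.keys p \<subseteq> S"
  shows "cpoly_pderiv j p =
    (\<Sum>e\<in>S. Poly_Mapping.single (e - Poly_Mapping.single j 1)
      (of_nat (Poly_Mapping.lookup e j) * Poly_Mapping.lookup p e))"
  unfolding cpoly_pderiv_def
  by (rule sum.mono_neutral_left) (use assms in \<open>auto simp: in_keys_iff\<close>)

lemma cpoly_pderiv_add: "cpoly_pderiv j (p + q) = cpoly_pderiv j p + cpoly_pderiv j q"
proof -
  let ?S = "Poly_Mapping.keys p \<union> Poly_Mapping.keys q"
  have "Poly_Mapping.keys (p + q) \<subseteq> ?S" by (rule Poly_Mapping.keys_add)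
  then show ?thesis
    by (simp add: cpoly_pderiv_superset[of ?S] lookup_add algebra_simps single_add sum.distrib)
qed

lemma weyl_ops_add: "P \<in> weyl_ops \<Longrightarrow> P (p + q) = P p + P q"
  by (induction arbitrary: p q rule: weyl_ops.induct)
     (simp_all add: distrib_left cpoly_pderiv_add add_ac)

typedef 'v weyl = "weyl_ops :: ('v cpoly \<Rightarrow> 'v cpoly) set"
  morphisms weyl_apply Abs_weyl
  by (rule exI, rule weyl_ops.pderiv)

setup_lifting type_definition_weyl

lemma cpoly_const_simps: "cpoly_const 0 = 0" "cpoly_const 1 = 1" "cpoly_const (- 1) = - 1"
  by (simp_all add: cpoly_const_def single_uminus)

instantiation weyl :: (type) ring_1
begin

lift_definition zero_weyl :: "'a weyl" is "\<lambda>_. 0"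
  by (rule weyl_ops.const[of 0, unfolded cpoly_const_simps mult_zero_left])
lift_definition one_weyl :: "'a weyl" is "\<lambda>p. p"
  by (rule weyl_ops.const[of 1, unfolded cpoly_const_simps mult_1_left])
lift_definition plus_weyl :: "'a weyl \<Rightarrow> 'a weyl \<Rightarrow> 'a weyl" is "\<lambda>P Q p. P p + Q p"
  by (rule weyl_ops.add)
lift_definition uminus_weyl :: "'a weyl \<Rightarrow> 'a weyl" is "\<lambda>P p. - P p"
  using weyl_ops.comp[OF weyl_ops.const[of "- 1"]] by (simp add: cpoly_const_simps)
definition minus_weyl :: "'a weyl \<Rightarrow> 'a weyl \<Rightarrow> 'a weyl" where
  "minus_weyl P Q = P + - Q"
lift_definition times_weyl :: "'a weyl \<Rightarrow> 'a weyl \<Rightarrow> 'a weyl" is "\<lambda>P Q p. P (Q p)"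
  by (rule weyl_ops.comp)

instance
proof
  fix P Q R :: "'a weyl"
  show "P * (Q + R) = P * Q + P * R"
    by transfer (simp add: weyl_ops_add)
  show "(0::'a weyl) \<noteq> 1"
    by transfer (metis zero_neq_one)
  show "P - Q = P + - Q" by (rule minus_weyl_def)
qed (transfer; simp add: fun_eq_iff add_ac)+

end

lift_definition weyl_const :: "complex \<Rightarrow> 'v weyl" is "\<lambda>c p. cpoly_const c * p"
  by (rule weyl_ops.const)
lift_definition weyl_x :: "'v \<Rightarrow> 'v weyl" is "\<lambda>j p. cpoly_var j * p"
  by (rule weyl_ops.var)
lift_definition weyl_d :: "'v \<Rightarrow> 'v weyl" is cpoly_pderiv
  by (rule weyl_ops.pderiv)

definition weyl_theta :: "'v \<Rightarrow> 'v weyl" where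
  "weyl_theta j = weyl_x j * weyl_d j"

text \<open>
  The value of a polynomial at a family \<open>T\<close> of pairwise commuting operators. The product of the
  powers of the \<open>T j\<close> is a fold because the Weyl algebra is not commutative; by commutativity of
  \<open>T\<close> it does not depend on the order. It is used for the embeddings of \<open>\<complex>[\<partial>]\<close> (\<open>T = weyl_d\<close>)
  and of \<open>\<complex>[\<theta>]\<close> (\<open>T = weyl_theta\<close>).
\<close>

definition weyl_eval :: "('v \<Rightarrow> 'v weyl) \<Rightarrow> 'v cpoly \<Rightarrow> 'v weyl" where
  "weyl_eval T p =
    (\<Sum>e\<in>Poly_Mapping.keys p. weyl_const (Poly_Mapping.lookup p e) *
      Finite_Set.fold (\<lambda>j P. T j ^ Poly_Mapping.lookup e j * P) 1 (Poly_Mapping.keys e))"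


section \<open>Toric ideals, initial ideals and fake exponents\<close>

definition toric_ideal :: "int^'n^'d \<Rightarrow> 'n::finite cpoly set" where
  "toric_ideal A = left_ideal_gen UNIV
    {Poly_Mapping.single u 1 - Poly_Mapping.single v 1 | u v.
      \<forall>i. (\<Sum>j\<in>UNIV. A $ i $ j * int (Poly_Mapping.lookup u j)) =
          (\<Sum>j\<in>UNIV. A $ i $ j * int (Poly_Mapping.lookup v j))}"

definition exponent_weight :: "real^'n \<Rightarrow> ('n::finite \<Rightarrow>\<^sub>0 nat) \<Rightarrow> real" where
  "exponent_weight w u = (\<Sum>j\<in>UNIV. w $ j * real (Poly_Mapping.lookup u j))"

definition initial_form :: "real^'n \<Rightarrow> 'n::finite cpoly \<Rightarrow> 'n cpoly" where
  "initial_form w f =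
    (\<Sum>u | u \<in> Poly_Mapping.keys f \<and>
          (\<forall>v\<in>Poly_Mapping.keys f. exponent_weight w v \<le> exponent_weight w u).
      Poly_Mapping.single u (Poly_Mapping.lookup f u))"

definition initial_ideal :: "real^'n \<Rightarrow> 'n::finite cpoly set \<Rightarrow> 'n cpoly set" where
  "initial_ideal w I = left_ideal_gen UNIV (initial_form w ` I)"

definition monomial_ideal :: "'v cpoly set \<Rightarrow> bool" where
  "monomial_ideal I \<longleftrightarrow> (\<exists>S. I = left_ideal_gen UNIV ((\<lambda>u. Poly_Mapping.single u 1) ` S))"

definition generic_weight :: "int^'n^'d \<Rightarrow> real^'n::finite \<Rightarrow> bool" where
  "generic_weight A w \<longleftrightarrow> monomial_ideal (initial_ideal w (toric_ideal A))"

definition euler_poly :: "int^'n^'d \<Rightarrow> complex^'d \<Rightarrow> 'd \<Rightarrow> 'n::finite cpoly" where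
  "euler_poly A \<beta> i = (\<Sum>j\<in>UNIV. cpoly_const (of_int (A $ i $ j)) * cpoly_var j)
    - cpoly_const (\<beta> $ i)"

text \<open>
  The intersection of the left ideal of the Weyl algebra generated by the initial ideal with
  \<open>\<complex>[\<theta>]\<close> appears as its preimage under the embedding of \<open>\<complex>[\<theta>]\<close>.
\<close>

definition fake_indicial_ideal :: "int^'n^'d \<Rightarrow> complex^'d \<Rightarrow> real^'n \<Rightarrow> 'n::finite cpoly set" where
  "fake_indicial_ideal A \<beta> w = ideal_sum
    {p. weyl_eval weyl_theta p
          \<in> left_ideal_gen UNIV (weyl_eval weyl_d ` initial_ideal w (toric_ideal A))}
    (left_ideal_gen UNIV (range (euler_poly A \<beta>)))"

definition fake_exponent :: "int^'n^'d \<Rightarrow> complex^'d \<Rightarrow> real^'n \<Rightarrow> complex^'n::finite \<Rightarrow> bool" where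
  "fake_exponent A \<beta> w v \<longleftrightarrow> (\<forall>p\<in>fake_indicial_ideal A \<beta> w. cpoly_eval (($) v) p = 0)"


section \<open>Configurations and negative supports\<close>

definition cols_on_hyperplane :: "int^'n^'d::finite \<Rightarrow> bool" where
  "cols_on_hyperplane A \<longleftrightarrow> (\<exists>(c::rat^'d) (r::rat). c \<noteq> 0 \<and> r \<noteq> 0 \<and>
     (\<forall>j. (\<Sum>i\<in>UNIV. c $ i * of_int (A $ i $ j)) = r))"

definition int_kernel :: "int^'n^'d \<Rightarrow> (int^'n::finite) set" where
  "int_kernel A = {u. A *v u = 0}"

definition complex_kernel :: "int^'n^'d \<Rightarrow> (complex^'n::finite) set" where
  "complex_kernel A = {z. map_matrix of_int A *v z = 0}"

definition neg_supp :: "complex^'n \<Rightarrow> int^'n \<Rightarrow> 'n::finite set" where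
  "neg_supp v u = {j. \<exists>k::int. k < 0 \<and> v $ j + of_int (u $ j) = of_int k}"

definition neg_supps :: "int^'n^'d \<Rightarrow> complex^'n \<Rightarrow> 'n::finite set set" where
  "neg_supps A v = neg_supp v ` int_kernel A"

definition nonneg_neg_supps :: "int^'n^'d \<Rightarrow> real^'n \<Rightarrow> complex^'n \<Rightarrow> 'n::finite set set" where
  "nonneg_neg_supps A w v =
    {I \<in> neg_supps A v. \<forall>u\<in>int_kernel A. neg_supp v u = I \<longrightarrow>
      (\<Sum>j\<in>UNIV. w $ j * of_int (u $ j)) \<ge> 0}"

definition neg_supp_family ::
    "int^'n^'d \<Rightarrow> real^'n \<Rightarrow> complex^'n \<Rightarrow> 'n::finite set set \<Rightarrow> bool" where
  "neg_supp_family A w v N \<longleftrightarrow> neg_supp v 0 \<in> N \<and> N \<subseteq> nonneg_neg_supps A w v"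

definition ordered_neg_supp_family ::
    "int^'n^'d \<Rightarrow> real^'n \<Rightarrow> complex^'n \<Rightarrow> 'n::finite set set \<Rightarrow> bool" where
  "ordered_neg_supp_family A w v N \<longleftrightarrow> neg_supp_family A w v N \<and>
    (\<forall>I\<in>N. \<forall>J\<in>neg_supps A v. J \<subseteq> I \<longrightarrow> J \<in> N)"

definition family_compl :: "int^'n^'d \<Rightarrow> complex^'n \<Rightarrow> 'n::finite set set \<Rightarrow> 'n set set" where
  "family_compl A v N = neg_supps A v - N"


section \<open>The ambient ideals\<close>

definition t_mon :: "'n::finite set \<Rightarrow> 'n mps" where
  "t_mon S = (\<Prod>j\<in>S. mps_var j)"

definition m_hat :: "complex^'n \<Rightarrow> 'n::finite set set \<Rightarrow> 'n mps" where
  "m_hat v N = t_mon (neg_supp v 0 - \<Inter>N)"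

definition M_hat :: "'n::finite set set \<Rightarrow> 'n mps set" where
  "M_hat N = left_ideal_gen UNIV {t_mon (I - \<Inter>N) | I. I \<in> N}"

definition P_hat :: "int^'n^'d \<Rightarrow> complex^'n \<Rightarrow> 'n::finite set set \<Rightarrow> 'n mps set" where
  "P_hat A v N =
    left_ideal_gen UNIV {t_mon ((I \<union> J) - \<Inter>N) | I J. I \<in> N \<and> J \<in> family_compl A v N}"

definition At_ideal :: "int^'n^'d \<Rightarrow> 'n::finite mps set" where
  "At_ideal A =
    left_ideal_gen UNIV (range (\<lambda>i. \<Sum>j\<in>UNIV. mps_const (of_int (A $ i $ j)) * mps_var j))"

definition Q_hat :: "int^'n^'d \<Rightarrow> complex^'n \<Rightarrow> 'n::finite set set \<Rightarrow> 'n mps set" where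
  "Q_hat A v N = ideal_sum (ideal_prod UNIV (At_ideal A) (M_hat N)) (P_hat A v N)"


section \<open>The intrinsic ideals\<close>

text \<open>
  The basis \<open>b 0, \<dots>, b (m - 1)\<close> and the variables \<open>s\<^sub>0, \<dots>, s\<^bsub>m-1\<^esub>\<close> are indexed by the naturals
  below \<open>m = n - d\<close>, and the power series ring in \<open>s\<close> is \<open>mps_ring {..<m}\<close>. Since types are
  nonempty, an index type for the variables would exclude \<open>m = 0\<close>.
\<close>

definition is_kernel_basis :: "int^'n^'d::finite \<Rightarrow> (nat \<Rightarrow> complex^'n::finite) \<Rightarrow> bool" where
  "is_kernel_basis A b \<longleftrightarrow>
    (let K = {..<CARD('n) - CARD('d)} in
      inj_on b K \<and> vec.independent (b ` K) \<and> vec.span (b ` K) = complex_kernel A)"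

definition s_form :: "nat \<Rightarrow> (nat \<Rightarrow> complex^'n) \<Rightarrow> 'n::finite \<Rightarrow> nat mps" where
  "s_form m b j = (\<Sum>k<m. mps_const (b k $ j) * mps_var k)"

definition s_mon :: "nat \<Rightarrow> (nat \<Rightarrow> complex^'n) \<Rightarrow> 'n::finite set \<Rightarrow> nat mps" where
  "s_mon m b S = (\<Prod>j\<in>S. s_form m b j)"

definition m_s :: "nat \<Rightarrow> (nat \<Rightarrow> complex^'n) \<Rightarrow> complex^'n \<Rightarrow> 'n::finite set set \<Rightarrow> nat mps" where
  "m_s m b v N = s_mon m b (neg_supp v 0 - \<Inter>N)"

definition P_s :: "int^'n^'d \<Rightarrow> nat \<Rightarrow> (nat \<Rightarrow> complex^'n) \<Rightarrow> complex^'n \<Rightarrow> 'n::finite set set \<Rightarrow> nat mps set" where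
  "P_s A m b v N = left_ideal_gen (mps_ring {..<m})
    {s_mon m b ((I \<union> J) - \<Inter>N) | I J. I \<in> N \<and> J \<in> family_compl A v N}"

definition P_s_at_zero ::
    "int^'n^'d \<Rightarrow> nat \<Rightarrow> (nat \<Rightarrow> complex^'n) \<Rightarrow> complex^'n \<Rightarrow> 'n::finite set set \<Rightarrow> nat mps set" where
  "P_s_at_zero A m b v N = left_ideal_gen (mps_ring {..<m})
    {s_mon m b (J - neg_supp v 0) | J. J \<in> family_compl A v N}"

definition Phi :: "nat \<Rightarrow> (nat \<Rightarrow> complex^'n) \<Rightarrow> 'n::finite mps \<Rightarrow> nat mps" where
  "Phi m b = mps_subst (s_form m b)"

end

theory Submission
  imports Defs
begin

text \<open>
  Substituting linear forms respects total degree, so only finitely many terms of a power series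
  contribute to each coefficient and \<open>Phi\<close> is a ring homomorphism. It kills \<open>At_ideal\<close> because the
  \<open>b k\<close> lie in the kernel of \<open>A\<close>, and it sends \<open>t_mon S\<close> to \<open>s_mon S\<close>; this gives one inclusion.
  Conversely, linear functionals dual to the \<open>b k\<close> show that \<open>Phi\<close> maps onto the power series in
  \<open>s\<close>, and by hypothesis it remains to lift the generators \<open>s_mon (J - I\<^sub>0)\<close>, where
  \<open>I\<^sub>0 = neg_supp v0 0\<close>. Since \<open>\<Inter>N \<subseteq> I\<^sub>0\<close>, the product of \<open>t_mon (J - I\<^sub>0)\<close> and \<open>m_hat\<close> is the
  generator \<open>t_mon ((I\<^sub>0 \<union> J) - \<Inter>N)\<close> of \<open>P_hat\<close>.
\<close>

section \<open>Ideals\<close>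

lemma left_ideal_gen_zero: "0 \<in> left_ideal_gen R G"
  unfolding left_ideal_gen_def by (intro CollectI exI[of _ "{}"]) auto

lemma left_ideal_gen_add:
  assumes R: "0 \<in> R" "\<And>x y. x \<in> R \<Longrightarrow> y \<in> R \<Longrightarrow> x + y \<in> R"
    and "f \<in> left_ideal_gen R G" "g \<in> left_ideal_gen R G"
  shows "f + g \<in> left_ideal_gen R G"
proof -
  obtain F c where F: "f = (\<Sum>x\<in>F. c x * x)" "finite F" "F \<subseteq> G" "\<forall>x\<in>F. c x \<in> R"
    using assms(3) unfolding left_ideal_gen_def by blast
  obtain H d where H: "g = (\<Sum>x\<in>H. d x * x)" "finite H" "H \<subseteq> G" "\<forall>x\<in>H. d x \<in> R"
    using assms(4) unfolding left_ideal_gen_def by blast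
  \<comment> \<open>The two combinations may use different generators, so both are extended by zero
    coefficients to \<open>F \<union> H\<close>.\<close>
  let ?c = "\<lambda>x. if x \<in> F then c x else 0" and ?d = "\<lambda>x. if x \<in> H then d x else 0"
  have "f = (\<Sum>x\<in>F \<union> H. ?c x * x)"
    unfolding F(1) by (rule sum.mono_neutral_cong_left) (use F H in auto)
  moreover have "g = (\<Sum>x\<in>F \<union> H. ?d x * x)"
    unfolding H(1) by (rule sum.mono_neutral_cong_left) (use F H in auto)
  ultimately have "f + g = (\<Sum>x\<in>F \<union> H. (?c x + ?d x) * x)"
    by (simp add: sum.distrib distrib_right)
  moreover have "\<forall>x\<in>F \<union> H. ?c x + ?d x \<in> R"
    using R F(4) H(4) by auto
  ultimately show ?thesis
    unfolding left_ideal_gen_def using F H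
    by (intro CollectI exI[of _ "F \<union> H"] exI[of _ "\<lambda>x. ?c x + ?d x"]) auto
qed

lemma left_ideal_gen_mult:
  assumes R: "\<And>x y. x \<in> R \<Longrightarrow> y \<in> R \<Longrightarrow> x * y \<in> R"
    and "r \<in> R" "f \<in> left_ideal_gen R G"
  shows "r * f \<in> left_ideal_gen R G"
proof -
  obtain F c where F: "f = (\<Sum>x\<in>F. c x * x)" "finite F" "F \<subseteq> G" "\<forall>x\<in>F. c x \<in> R"
    using assms(3) unfolding left_ideal_gen_def by blast
  have "r * f = (\<Sum>x\<in>F. (r * c x) * x)"
    unfolding F(1) by (simp add: sum_distrib_left mult.assoc)
  with F R \<open>r \<in> R\<close> show ?thesis
    unfolding left_ideal_gen_def
    by (intro CollectI exI[of _ F] exI[of _ "\<lambda>x. r * c x"]) auto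
qed

lemma left_ideal_gen_superset:
  assumes "1 \<in> R" "x \<in> G"
  shows "x \<in> left_ideal_gen R G"
  unfolding left_ideal_gen_def
  using assms by (intro CollectI exI[of _ "{x}"] exI[of _ "\<lambda>_. 1"]) auto

text \<open>Serves as an induction principle for members of a generated ideal. Later
  \<open>S\<close> is the kernel of \<open>Phi\<close>, a preimage under \<open>Phi\<close> or an
  image under \<open>Phi\<close>.\<close>

lemma left_ideal_gen_least:
  assumes "0 \<in> S" "\<And>x y. x \<in> S \<Longrightarrow> y \<in> S \<Longrightarrow> x + y \<in> S"
    "\<And>r x. r \<in> R \<Longrightarrow> x \<in> S \<Longrightarrow> r * x \<in> S" "G \<subseteq> S"
  shows "left_ideal_gen R G \<subseteq> S"
proof
  fix f assume "f \<in> left_ideal_gen R G"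
  then obtain F c where F: "f = (\<Sum>x\<in>F. c x * x)" "finite F" "F \<subseteq> G" "\<forall>x\<in>F. c x \<in> R"
    unfolding left_ideal_gen_def by blast
  from F(2-4) have "(\<Sum>x\<in>F. c x * x) \<in> S"
    by (induction F rule: finite_induct) (use assms in auto)
  then show "f \<in> S" using F by simp
qed

lemma subset_ideal_sum_right: "0 \<in> I \<Longrightarrow> J \<subseteq> ideal_sum I J"
  unfolding ideal_sum_def by force


section \<open>Total degree of exponents\<close>

definition total_degree :: "('v \<Rightarrow>\<^sub>0 nat) \<Rightarrow> nat" where
  "total_degree e = (\<Sum>j\<in>Poly_Mapping.keys e. Poly_Mapping.lookup e j)"

lemma total_degree_zero [simp]: "total_degree 0 = 0"
  by (simp add: total_degree_def)

lemma total_degree_single [simp]: "total_degree (Poly_Mapping.single j n) = n"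
  by (simp add: total_degree_def)

lemma total_degree_add [simp]: "total_degree (e + e') = total_degree e + total_degree e'"
  unfolding total_degree_def by (rule setsum_keys_plus_distrib) auto

lemma lookup_le_total_degree: "Poly_Mapping.lookup e j \<le> total_degree e"
  unfolding total_degree_def
  by (cases "j \<in> Poly_Mapping.keys e") (auto simp: in_keys_iff intro: member_le_sum)

text \<open>Such an exponent is a function from \<open>V\<close> to \<open>{..n}\<close> extended by
  0. This provides the finite index sets for the substitution arguments.\<close>

lemma finite_total_degree_le:
  assumes "finite V"
  shows "finite {e. Poly_Mapping.keys e \<subseteq> V \<and> total_degree e \<le> n}"
proof -
  let ?F = "{f. \<forall>x. (x \<in> V \<longrightarrow> f x \<in> {..n}) \<and> (x \<notin> V \<longrightarrow> f x = (0::nat))}"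
  have "Poly_Mapping.lookup ` {e. Poly_Mapping.keys e \<subseteq> V \<and> total_degree e \<le> n} \<subseteq> ?F"
    by (auto simp: in_keys_iff intro: order_trans[OF lookup_le_total_degree])
  moreover have "finite ?F"
    using assms by (intro finite_set_of_finite_funs) auto
  ultimately show ?thesis
    by (meson finite_subset finite_imageD inj_on_def lookup_inject)
qed


section \<open>Power series rings and homogeneous power series\<close>

lemma mps_coeff_sum: "mps_coeff (\<Sum>x\<in>F. f x) e = (\<Sum>x\<in>F. mps_coeff (f x) e)"
  by (induction F rule: infinite_finite_induct) (auto simp: zero_mps.rep_eq plus_mps.rep_eq)

lemma mps_coeff_times_nonzeroE:
  assumes "mps_coeff (f * g) e \<noteq> 0"
  obtains p q where "e = p + q" "mps_coeff f p \<noteq> 0" "mps_coeff g q \<noteq> 0"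
proof -
  have "\<exists>pq\<in>{(p, q). p + q = e}. (case pq of (p, q) \<Rightarrow> mps_coeff f p * mps_coeff g q) \<noteq> 0"
    using assms unfolding times_mps.rep_eq by (meson sum.neutral)
  then show ?thesis using that by auto
qed

lemma mps_const_one: "mps_const 1 = 1"
  by (rule mps_eqI) (simp add: mps_const.rep_eq one_mps.rep_eq)

lemma mps_coeff_const_mult: "mps_coeff (mps_const c * f) e = c * mps_coeff f e"
proof -
  \<comment> \<open>A constant is supported at the exponent 0, so only the splitting
    \<open>(0, e)\<close> contributes.\<close>
  have "mps_coeff (mps_const c * f) e =
      (\<Sum>(a, b)\<in>{(a, b). a + b = e}. if (a, b) = (0, e) then c * mps_coeff f e else 0)"
    unfolding times_mps.rep_eq mps_const.rep_eq by (rule sum.cong) auto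
  also have "\<dots> = c * mps_coeff f e"
    using sum.delta[OF finite_exponent_splits[of e], of "(0, e)" "\<lambda>_. c * mps_coeff f e"]
    by (simp add: case_prod_unfold prod_eq_iff)
  finally show ?thesis .
qed

lemma mps_ring_zero: "0 \<in> mps_ring V"
  by (simp add: mps_ring_def zero_mps.rep_eq)

lemma mps_ring_one: "1 \<in> mps_ring V"
  by (simp add: mps_ring_def one_mps.rep_eq)

lemma mps_ring_const: "mps_const c \<in> mps_ring V"
  by (simp add: mps_ring_def mps_const.rep_eq)

lemma mps_ring_var: "j \<in> V \<Longrightarrow> mps_var j \<in> mps_ring V"
  by (simp add: mps_ring_def mps_var.rep_eq)

lemma mps_ring_add: "f \<in> mps_ring V \<Longrightarrow> g \<in> mps_ring V \<Longrightarrow> f + g \<in> mps_ring V"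
  by (simp add: mps_ring_def plus_mps.rep_eq) (metis add_0)

lemma mps_ring_mult:
  assumes "f \<in> mps_ring V" "g \<in> mps_ring V"
  shows "f * g \<in> mps_ring V"
  unfolding mps_ring_def
proof (intro CollectI allI impI)
  fix e assume "mps_coeff (f * g) e \<noteq> 0"
  then obtain p q where "e = p + q" "mps_coeff f p \<noteq> 0" "mps_coeff g q \<noteq> 0"
    by (rule mps_coeff_times_nonzeroE)
  with assms show "Poly_Mapping.keys e \<subseteq> V"
    using Poly_Mapping.keys_add[of p q] unfolding mps_ring_def by blast
qed

lemma mps_ring_sum: "(\<And>x. x \<in> F \<Longrightarrow> f x \<in> mps_ring V) \<Longrightarrow> (\<Sum>x\<in>F. f x) \<in> mps_ring V"
  by (induction F rule: infinite_finite_induct) (auto simp: mps_ring_zero mps_ring_add)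

lemma mps_ring_prod: "(\<And>x. x \<in> F \<Longrightarrow> f x \<in> mps_ring V) \<Longrightarrow> (\<Prod>x\<in>F. f x) \<in> mps_ring V"
  by (induction F rule: infinite_finite_induct) (auto simp: mps_ring_one mps_ring_mult)

lemma mps_ring_power: "f \<in> mps_ring V \<Longrightarrow> f ^ n \<in> mps_ring V"
  by (induction n) (auto simp: mps_ring_one mps_ring_mult)

text \<open>The zero series is homogeneous of every degree, so cancellation in a sum does no
  harm.\<close>

definition mps_homogeneous :: "nat \<Rightarrow> 'v mps \<Rightarrow> bool" where
  "mps_homogeneous n f \<longleftrightarrow> (\<forall>e. mps_coeff f e \<noteq> 0 \<longrightarrow> total_degree e = n)"

lemma mps_homogeneous_one: "mps_homogeneous 0 1"
  by (simp add: mps_homogeneous_def one_mps.rep_eq)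

lemma mps_homogeneous_var: "mps_homogeneous 1 (mps_var j)"
  by (simp add: mps_homogeneous_def mps_var.rep_eq)

lemma mps_homogeneous_mult:
  "mps_homogeneous a f \<Longrightarrow> mps_homogeneous b g \<Longrightarrow> mps_homogeneous (a + b) (f * g)"
  unfolding mps_homogeneous_def by (metis mps_coeff_times_nonzeroE total_degree_add)

lemma mps_homogeneous_const_mult: "mps_homogeneous n f \<Longrightarrow> mps_homogeneous n (mps_const c * f)"
  by (simp add: mps_homogeneous_def mps_coeff_const_mult)

lemma mps_homogeneous_sum:
  assumes "\<And>x. x \<in> F \<Longrightarrow> mps_homogeneous n (f x)"
  shows "mps_homogeneous n (\<Sum>x\<in>F. f x)"
  unfolding mps_homogeneous_def mps_coeff_sum
  using assms by (meson mps_homogeneous_def sum.neutral)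

lemma mps_homogeneous_power: "mps_homogeneous a f \<Longrightarrow> mps_homogeneous (n * a) (f ^ n)"
  by (induction n) (auto simp: mps_homogeneous_one intro: mps_homogeneous_mult)

lemma mps_homogeneous_prod:
  "(\<And>x. x \<in> F \<Longrightarrow> mps_homogeneous (d x) (f x)) \<Longrightarrow>
    mps_homogeneous (\<Sum>x\<in>F. d x) (\<Prod>x\<in>F. f x)"
  by (induction F rule: infinite_finite_induct)
     (auto simp: mps_homogeneous_one intro: mps_homogeneous_mult)


section \<open>Substitution of linear forms\<close>

text \<open>The image of the monomial with exponent \<open>u\<close>; \<open>mps_subst\<close>
  contains this product unnamed.\<close>

definition subst_monomial :: "('v \<Rightarrow> 'k mps) \<Rightarrow> ('v \<Rightarrow>\<^sub>0 nat) \<Rightarrow> 'k mps" where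
  "subst_monomial g u = (\<Prod>j\<in>Poly_Mapping.keys u. g j ^ Poly_Mapping.lookup u j)"

text \<open>Factors outside the keys have exponent 0 and equal 1. In
  \<open>subst_monomial_add\<close> this puts exponents with different keys over a common index
  set.\<close>

lemma subst_monomial_superset:
  "finite V \<Longrightarrow> Poly_Mapping.keys u \<subseteq> V \<Longrightarrow>
    subst_monomial g u = (\<Prod>j\<in>V. g j ^ Poly_Mapping.lookup u j)"
  unfolding subst_monomial_def
  by (rule prod.mono_neutral_left) (auto simp: in_keys_iff)

lemma subst_monomial_zero [simp]: "subst_monomial g 0 = 1"
  by (simp add: subst_monomial_def)

lemma subst_monomial_single [simp]: "subst_monomial g (Poly_Mapping.single j n) = g j ^ n"
  by (simp add: subst_monomial_def)

lemma subst_monomial_add: "subst_monomial g (u + v) = subst_monomial g u * subst_monomial g v"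
  using Poly_Mapping.keys_add[of u v]
  by (simp add: subst_monomial_superset[of "Poly_Mapping.keys u \<union> Poly_Mapping.keys v"]
      lookup_add power_add prod.distrib)

lemma subst_monomial_homogeneous:
  assumes "\<And>j. j \<in> Poly_Mapping.keys u \<Longrightarrow> mps_homogeneous 1 (g j)"
  shows "mps_homogeneous (total_degree u) (subst_monomial g u)"
  unfolding subst_monomial_def total_degree_def
  using assms mps_homogeneous_power[of 1] by (intro mps_homogeneous_prod) fastforce

text \<open>One variable at a time is split off, by induction on the total degree.
  \<open>subst_surj\<close> uses the result to read off coefficients.\<close>

lemma mps_coeff_subst_monomial_var:
  "mps_coeff (subst_monomial mps_var u) e = (if e = u then 1 else 0)"
proof (induction u arbitrary: e rule: measure_induct_rule[of total_degree])
  case (less u)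
  show ?case
  proof (cases "u = 0")
    case True
    then show ?thesis by (simp add: one_mps.rep_eq)
  next
    case False
    then obtain j where j: "Poly_Mapping.lookup u j \<noteq> 0"
      by (metis lookup_zero poly_mapping_eqI)
    \<comment> \<open>The exponent of \<open>j\<close> in \<open>u\<close> is positive, so the
      truncated subtraction loses nothing.\<close>
    define u' where "u' = u - Poly_Mapping.single j 1"
    have u: "u = u' + Poly_Mapping.single j 1"
      using j by (intro poly_mapping_eqI) (auto simp: u'_def lookup_add lookup_minus lookup_single when_def)
    have IH: "mps_coeff (subst_monomial mps_var u') p = (if p = u' then 1 else 0)" for p
      by (rule less) (simp add: u)
    have "mps_coeff (subst_monomial mps_var u) e =
        (\<Sum>x\<in>{(p, q). p + q = e}. if x = (u', Poly_Mapping.single j 1) then 1 else 0)"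
      unfolding u subst_monomial_add times_mps.rep_eq
      by (rule sum.cong) (auto simp: IH mps_var.rep_eq split: if_splits)
    also have "\<dots> = (if e = u then 1 else 0)"
      using sum.delta[OF finite_exponent_splits[of e], of "(u', Poly_Mapping.single j 1)" "\<lambda>_. 1::complex"]
      by (auto simp: u)
    finally show ?thesis .
  qed
qed

lemma mps_subst_in_mps_ring:
  assumes "\<And>j. g j \<in> mps_ring V"
  shows "mps_subst g f \<in> mps_ring V"
  unfolding mps_ring_def
proof (intro CollectI allI impI)
  fix e assume "mps_coeff (mps_subst g f) e \<noteq> 0"
  then obtain u where "mps_coeff (subst_monomial g u) e \<noteq> 0"
    unfolding mps_subst.rep_eq subst_monomial_def
    by (metis (mono_tags, lifting) mem_Collect_eq sum.neutral)
  moreover have "subst_monomial g u \<in> mps_ring V"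
    unfolding subst_monomial_def by (intro mps_ring_prod mps_ring_power assms)
  ultimately show "Poly_Mapping.keys e \<subseteq> V"
    by (simp add: mps_ring_def)
qed

text \<open>With finitely many variables and linear \<open>g j\<close>, only the finitely many
  \<open>u\<close> of the same degree as \<open>e\<close> can contribute to the coefficient at
  \<open>e\<close>. Hence the sum in \<open>mps_subst\<close> does not collapse to 0, the default
  value of a sum over an infinite set.\<close>

locale linear_substitution =
  fixes g :: "'v::finite \<Rightarrow> 'k mps"
  assumes linear: "mps_homogeneous 1 (g j)"
begin

lemma coeff_subst_monomial_eq_0:
  "total_degree e \<noteq> total_degree u \<Longrightarrow> mps_coeff (subst_monomial g u) e = 0"
  using subst_monomial_homogeneous[of u g, OF linear] unfolding mps_homogeneous_def by blast

text \<open>The index set in \<open>mps_subst\<close> varies with \<open>e\<close>. A degree bound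
  \<open>n\<close> gives one finite set that serves several exponents at once, as
  \<open>subst_mult\<close> requires.\<close>

lemma coeff_subst:
  assumes "total_degree e \<le> n"
  shows "mps_coeff (mps_subst g f) e =
    (\<Sum>u | total_degree u \<le> n. mps_coeff f u * mps_coeff (subst_monomial g u) e)"
  unfolding mps_subst.rep_eq subst_monomial_def[symmetric]
proof (rule sum.mono_neutral_left)
  show "finite {u :: 'v \<Rightarrow>\<^sub>0 nat. total_degree u \<le> n}"
    using finite_total_degree_le[of "UNIV :: 'v set" n] by simp
  show "{u. mps_coeff (subst_monomial g u) e \<noteq> 0} \<subseteq> {u. total_degree u \<le> n}"
    using assms coeff_subst_monomial_eq_0 by force
qed auto

lemma subst_add: "mps_subst g (f + h) = mps_subst g f + mps_subst g h"
  by (rule mps_eqI) (simp add: coeff_subst[OF order_refl] plus_mps.rep_eq distrib_right sum.distrib)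

lemma subst_zero: "mps_subst g 0 = 0"
  by (rule mps_eqI) (simp add: coeff_subst[OF order_refl] zero_mps.rep_eq)

lemma subst_sum: "mps_subst g (\<Sum>x\<in>F. f x) = (\<Sum>x\<in>F. mps_subst g (f x))"
  by (induction F rule: infinite_finite_induct) (auto simp: subst_zero subst_add)

lemma subst_term:
  assumes "\<And>e. mps_coeff f e = (if e = u then c else 0)"
  shows "mps_subst g f = mps_const c * subst_monomial g u"
proof (rule mps_eqI)
  fix e :: "'k \<Rightarrow>\<^sub>0 nat"
  \<comment> \<open>The maximum keeps \<open>u\<close> in the range of summation even if its degree
    exceeds that of \<open>e\<close>.\<close>
  define n where "n = max (total_degree e) (total_degree u)"
  have "mps_coeff (mps_subst g f) e = (\<Sum>v | total_degree v \<le> n.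
      if v = u then c * mps_coeff (subst_monomial g u) e else 0)"
    unfolding coeff_subst[of e n, OF max.cobounded1[of "total_degree e" "total_degree u", folded n_def]]
    by (rule sum.cong) (auto simp: assms)
  also have "\<dots> = c * mps_coeff (subst_monomial g u) e"
    using finite_total_degree_le[of "UNIV :: 'v set" n] by (simp add: n_def)
  finally show "mps_coeff (mps_subst g f) e = mps_coeff (mps_const c * subst_monomial g u) e"
    by (simp add: mps_coeff_const_mult)
qed

lemma subst_const: "mps_subst g (mps_const c) = mps_const c"
  using subst_term[of "mps_const c" 0 c] by (simp add: mps_const.rep_eq)

lemma subst_var: "mps_subst g (mps_var j) = g j"
  using subst_term[of "mps_var j" "Poly_Mapping.single j 1" 1]
  by (simp add: mps_var.rep_eq mps_const_one)

lemma subst_one: "mps_subst g 1 = 1"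
  using subst_const[of 1] by (simp add: mps_const_one)

text \<open>
  At an exponent of degree \<open>n\<close> both sides are sums over pairs \<open>a\<close>, \<open>b\<close> of degree at most \<open>n\<close>;
  the pairs with \<open>total_degree (a + b) > n\<close> occur on one side only, with coefficient 0.
\<close>

lemma subst_mult: "mps_subst g (f * h) = mps_subst g f * mps_subst g h"
proof (rule mps_eqI)
  fix e :: "'k \<Rightarrow>\<^sub>0 nat"
  let ?n = "total_degree e"
  let ?U = "{u :: 'v \<Rightarrow>\<^sub>0 nat. total_degree u \<le> ?n}"
  let ?M = "\<lambda>u. mps_coeff (subst_monomial g u)"
  let ?t = "\<lambda>(a, b). mps_coeff f a * mps_coeff h b * ?M (a + b) e"
  have fin: "finite ?U"
    using finite_total_degree_le[of "UNIV :: 'v set" ?n] by simp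
  have "mps_coeff (mps_subst g (f * h)) e = (\<Sum>u\<in>?U. \<Sum>p\<in>{(a, b). a + b = u}. ?t p)"
    unfolding coeff_subst[OF order_refl] times_mps.rep_eq sum_distrib_right
    by (intro sum.cong) auto
  also have "\<dots> = (\<Sum>(u, p)\<in>Sigma ?U (\<lambda>u. {(a, b). a + b = u}). ?t p)"
    by (rule sum.Sigma) (use fin finite_exponent_splits in auto)
  \<comment> \<open>A pair determines its sum \<open>u\<close>, and neither member has larger degree
    than \<open>u\<close>.\<close>
  also have "\<dots> = (\<Sum>p\<in>{p \<in> ?U \<times> ?U. fst p + snd p \<in> ?U}. ?t p)"
    by (rule sum.reindex_bij_witness[where i = "\<lambda>p. (fst p + snd p, p)" and j = snd]) auto
  also have "\<dots> = (\<Sum>p\<in>?U \<times> ?U. ?t p)"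
  proof (rule sum.mono_neutral_left)
    show "finite (?U \<times> ?U)"
      using fin by simp
    show "\<forall>p\<in>?U \<times> ?U - {p \<in> ?U \<times> ?U. fst p + snd p \<in> ?U}. ?t p = 0"
      by (auto intro!: coeff_subst_monomial_eq_0)
  qed auto
  also have "\<dots> = (\<Sum>a\<in>?U. \<Sum>b\<in>?U. ?t (a, b))"
    by (simp add: sum.cartesian_product)
  also have "\<dots> = (\<Sum>a\<in>?U. \<Sum>b\<in>?U. \<Sum>(p, q)\<in>{(p, q). p + q = e}.
      (mps_coeff f a * ?M a p) * (mps_coeff h b * ?M b q))"
    by (simp add: subst_monomial_add times_mps.rep_eq sum_distrib_left case_prod_unfold mult_ac)
  also have "\<dots> = (\<Sum>(p, q)\<in>{(p, q). p + q = e}.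
      (\<Sum>a\<in>?U. mps_coeff f a * ?M a p) * (\<Sum>b\<in>?U. mps_coeff h b * ?M b q))"
    unfolding sum_product case_prod_unfold
    by (subst (2) sum.swap, subst sum.swap, intro sum.cong refl)
  \<comment> \<open>From \<open>p + q = e\<close> both \<open>p\<close> and \<open>q\<close> have
    degree at most \<open>?n\<close>, so the same bound expands both factors.\<close>
  also have "\<dots> = mps_coeff (mps_subst g f * mps_subst g h) e"
    unfolding times_mps.rep_eq
    by (intro sum.cong refl) (auto simp: coeff_subst[of _ ?n])
  finally show "mps_coeff (mps_subst g (f * h)) e = mps_coeff (mps_subst g f * mps_subst g h) e" .
qed

lemma subst_prod: "mps_subst g (\<Prod>x\<in>F. f x) = (\<Prod>x\<in>F. mps_subst g (f x))"
  by (induction F rule: infinite_finite_induct) (auto simp: subst_one subst_mult)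

lemma subst_power: "mps_subst g (f ^ n) = mps_subst g f ^ n"
  by (induction n) (auto simp: subst_one subst_mult)

text \<open>
  A preimage of \<open>c\<close> collects the terms \<open>c\<^sub>e h\<^sup>e\<close>; its coefficients are finite sums because \<open>h\<^sup>e\<close> is
  homogeneous of the degree of \<open>e\<close>.
\<close>

lemma subst_surj:
  assumes fin: "finite V"
    and h: "\<And>k. k \<in> V \<Longrightarrow> mps_homogeneous 1 (h k)"
    and gh: "\<And>k. k \<in> V \<Longrightarrow> mps_subst g (h k) = mps_var k"
    and c: "c \<in> mps_ring V"
  shows "\<exists>f. mps_subst g f = c"
proof -
  define E where "E n = {e. Poly_Mapping.keys e \<subseteq> V \<and> total_degree e \<le> n}" for n
  define f where "f = Abs_mps (\<lambda>u. \<Sum>e\<in>E (total_degree u).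
    mps_coeff c e * mps_coeff (subst_monomial h e) u)"
  have finE: "finite (E n)" for n
    unfolding E_def by (rule finite_total_degree_le[OF fin])
  have h0: "mps_coeff (subst_monomial h e) u = 0"
    if "e \<in> E n" "total_degree u \<noteq> total_degree e" for e u n
    using subst_monomial_homogeneous[of e h] h that unfolding mps_homogeneous_def E_def by blast
  \<comment> \<open>A range \<open>E n\<close> independent of \<open>u\<close> allows the sums over
    \<open>u\<close> and \<open>e\<close> to be exchanged below.\<close>
  have f: "mps_coeff f u = (\<Sum>e\<in>E n. mps_coeff c e * mps_coeff (subst_monomial h e) u)"
    if "total_degree u \<le> n" for u n
  proof -
    have "mps_coeff f u = (\<Sum>e\<in>E (total_degree u).
        mps_coeff c e * mps_coeff (subst_monomial h e) u)"
      by (simp add: f_def Abs_mps_inverse)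
    also have "\<dots> = (\<Sum>e\<in>E n. mps_coeff c e * mps_coeff (subst_monomial h e) u)"
    proof (rule sum.mono_neutral_left[OF finE])
      show "E (total_degree u) \<subseteq> E n"
        using that by (auto simp: E_def)
      show "\<forall>e\<in>E n - E (total_degree u). mps_coeff c e * mps_coeff (subst_monomial h e) u = 0"
      proof
        fix e assume e: "e \<in> E n - E (total_degree u)"
        then have "total_degree u \<noteq> total_degree e" by (auto simp: E_def)
        with e show "mps_coeff c e * mps_coeff (subst_monomial h e) u = 0"
          using h0[of e n u] by simp
      qed
    qed
    finally show ?thesis .
  qed
  have gm: "mps_subst g (subst_monomial h e) = subst_monomial mps_var e" if "e \<in> E n" for e n
    unfolding subst_monomial_def subst_prod subst_power
    using that by (intro prod.cong refl) (auto simp: E_def gh)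
  have "mps_subst g f = c"
  proof (rule mps_eqI)
    fix e' :: "'k \<Rightarrow>\<^sub>0 nat"
    let ?n = "total_degree e'"
    have "mps_coeff (mps_subst g f) e' = (\<Sum>u | total_degree u \<le> ?n. \<Sum>e\<in>E ?n.
        mps_coeff c e * (mps_coeff (subst_monomial h e) u * mps_coeff (subst_monomial g u) e'))"
      unfolding coeff_subst[OF order_refl]
      by (intro sum.cong refl) (simp add: f sum_distrib_right mult.assoc)
    \<comment> \<open>After the exchange, the inner sum over \<open>u\<close> is a coefficient of
      the image of \<open>subst_monomial h e\<close>, which by \<open>gm\<close> is a
      monomial.\<close>
    also have "\<dots> = (\<Sum>e\<in>E ?n. mps_coeff c e * mps_coeff (mps_subst g (subst_monomial h e)) e')"
      unfolding coeff_subst[OF order_refl] sum_distrib_left by (rule sum.swap)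
    also have "\<dots> = (\<Sum>e\<in>E ?n. if e = e' then mps_coeff c e' else 0)"
      by (intro sum.cong refl) (auto simp: gm mps_coeff_subst_monomial_var)
    \<comment> \<open>If \<open>e'\<close> is not in \<open>E ?n\<close>, its keys are not all in
      \<open>V\<close>, and then \<open>c\<close> has coefficient 0 there.\<close>
    also have "\<dots> = mps_coeff c e'"
      using c finE by (auto simp: mps_ring_def E_def)
    finally show "mps_coeff (mps_subst g f) e' = mps_coeff c e'" .
  qed
  then show ?thesis by blast
qed

end


section \<open>The substitution \<open>Phi\<close>\<close>

lemma s_form_homogeneous: "mps_homogeneous 1 (s_form m b j)"
  unfolding s_form_def
  by (intro mps_homogeneous_sum mps_homogeneous_const_mult mps_homogeneous_var)

interpretation Phi: linear_substitution "s_form m b"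
  rewrites "mps_subst (s_form m b) = Phi m b"
  by unfold_locales (rule s_form_homogeneous, simp add: Phi_def)

lemma Phi_in_mps_ring: "Phi m b f \<in> mps_ring {..<m}"
  unfolding Phi_def s_form_def
  by (intro mps_subst_in_mps_ring mps_ring_sum mps_ring_mult mps_ring_const mps_ring_var) simp

lemma Phi_t_mon: "Phi m b (t_mon S) = s_mon m b S"
  by (simp add: t_mon_def s_mon_def Phi.subst_prod Phi.subst_var)

text \<open>Exchanging the sums over \<open>j\<close> and \<open>k\<close> turns the coefficients
  into pairings of \<open>c\<close> with the \<open>b k\<close>. For a row of \<open>A\<close> these
  vanish; for a dual functional they single out one variable.\<close>

lemma Phi_linear_form:
  "Phi m b (\<Sum>j\<in>UNIV. mps_const (c j) * mps_var j) =
    (\<Sum>k<m. mps_const (\<Sum>j\<in>UNIV. c j * b k $ j) * mps_var k)"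
proof (rule mps_eqI)
  fix e
  have "mps_coeff (Phi m b (\<Sum>j\<in>UNIV. mps_const (c j) * mps_var j)) e =
      (\<Sum>j\<in>UNIV. \<Sum>k<m. c j * (b k $ j * mps_coeff (mps_var k) e))"
    by (simp add: Phi.subst_sum Phi.subst_mult Phi.subst_const Phi.subst_var s_form_def
        mps_coeff_sum mps_coeff_const_mult sum_distrib_left)
  also have "\<dots> = (\<Sum>k<m. \<Sum>j\<in>UNIV. c j * (b k $ j * mps_coeff (mps_var k) e))"
    by (rule sum.swap)
  also have "\<dots> = mps_coeff (\<Sum>k<m. mps_const (\<Sum>j\<in>UNIV. c j * b k $ j) * mps_var k) e"
    by (simp add: mps_coeff_sum mps_coeff_const_mult sum_distrib_right mult.assoc)
  finally show "mps_coeff (Phi m b (\<Sum>j\<in>UNIV. mps_const (c j) * mps_var j)) e =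
    mps_coeff (\<Sum>k<m. mps_const (\<Sum>j\<in>UNIV. c j * b k $ j) * mps_var k) e" .
qed

lemma Phi_At_ideal:
  assumes "\<And>k. k < m \<Longrightarrow> b k \<in> complex_kernel A" and "f \<in> At_ideal A"
  shows "Phi m b f = 0"
proof -
  have "At_ideal A \<subseteq> {f. Phi m b f = 0}"
    unfolding At_ideal_def
  proof (rule left_ideal_gen_least)
    have "Phi m b (\<Sum>j\<in>UNIV. mps_const (of_int (A $ i $ j)) * mps_var j) = 0" for i
    proof -
      have "(\<Sum>j\<in>UNIV. of_int (A $ i $ j) * b k $ j) = 0" if "k < m" for k
        using assms(1)[OF that]
        by (simp add: complex_kernel_def vec_eq_iff matrix_vector_mult_def map_matrix_def)
      then show ?thesis
        by (intro mps_eqI)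
           (simp add: Phi_linear_form mps_coeff_sum mps_coeff_const_mult zero_mps.rep_eq)
    qed
    then show "range (\<lambda>i. \<Sum>j\<in>UNIV. mps_const (of_int (A $ i $ j)) * mps_var j)
        \<subseteq> {f. Phi m b f = 0}"
      by auto
  qed (auto simp: Phi.subst_zero Phi.subst_add Phi.subst_mult)
  with assms(2) show ?thesis by blast
qed

section \<open>Surjectivity of \<open>Phi\<close>\<close>

lemma dual_functional:
  fixes b :: "nat \<Rightarrow> complex^'n::finite"
  assumes "inj_on b K" "vec.independent (b ` K)" "k \<in> K"
  shows "\<exists>c. \<forall>k'\<in>K. (\<Sum>j\<in>UNIV. c j * b k' $ j) = (if k' = k then 1 else 0)"
proof -
  \<comment> \<open>Here \<open>1\<close> is the all-ones vector. Once \<open>?e\<close> is extended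
    linearly from the independent set, every row of the resulting matrix is a dual functional, so
    any index \<open>i\<close> will do.\<close>
  let ?e = "\<lambda>x. if x = b k then 1 else 0 :: complex^'n"
  obtain \<phi> where \<phi>: "Vector_Spaces.linear (*s) (*s) \<phi>" "\<forall>x\<in>b ` K. \<phi> x = ?e x"
    using vec.linear_independent_extend[OF assms(2), of ?e] by blast
  obtain i :: 'n where True by simp
  have "(\<Sum>j\<in>UNIV. matrix \<phi> $ i $ j * b k' $ j) = (if k' = k then 1 else 0)" if "k' \<in> K" for k'
  proof -
    have "(\<Sum>j\<in>UNIV. matrix \<phi> $ i $ j * b k' $ j) = (matrix \<phi> *v b k') $ i"
      by (simp add: matrix_vector_mult_def)
    also have "\<dots> = ?e (b k') $ i"
      using \<phi> that by (simp add: matrix_works)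
    finally show ?thesis
      using inj_on_eq_iff[OF assms(1) that assms(3)] by simp
  qed
  then show ?thesis by blast
qed

lemma Phi_surj:
  assumes "inj_on b {..<m}" "vec.independent (b ` {..<m})" "c \<in> mps_ring {..<m}"
  shows "\<exists>f. Phi m b f = c"
proof -
  have "\<forall>k\<in>{..<m}. \<exists>d. \<forall>k'\<in>{..<m}. (\<Sum>j\<in>UNIV. d j * b k' $ j) = (if k' = k then 1 else 0)"
    using dual_functional[OF assms(1,2)] by blast
  then obtain d where d: "\<And>k k'. k < m \<Longrightarrow> k' < m \<Longrightarrow>
      (\<Sum>j\<in>UNIV. d k j * b k' $ j) = (if k' = k then 1 else 0)"
    unfolding bchoice_iff by (metis lessThan_iff)
  show ?thesis
  \<comment> \<open>The dual functionals, read as linear forms in \<open>t\<close>, are preimages of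
    the variables.\<close>
  proof (rule Phi.subst_surj[where h = "\<lambda>k. \<Sum>j\<in>UNIV. mps_const (d k j) * mps_var j"])
    fix k assume k: "k \<in> {..<m}"
    have "mps_coeff (Phi m b (\<Sum>j\<in>UNIV. mps_const (d k j) * mps_var j)) e =
        (\<Sum>k'<m. if k' = k then mps_coeff (mps_var k) e else 0)" for e
      unfolding Phi_linear_form mps_coeff_sum mps_coeff_const_mult
      using k by (intro sum.cong) (auto simp: d)
    then show "Phi m b (\<Sum>j\<in>UNIV. mps_const (d k j) * mps_var j) = mps_var k"
      using k by (intro mps_eqI) simp
  qed (use assms(3) in \<open>auto intro!: mps_homogeneous_sum mps_homogeneous_const_mult
    mps_homogeneous_var[simplified]\<close>)
qed

section \<open>The two inclusions between the colon ideals\<close>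

lemma Phi_Q_hat:
  assumes "\<And>k. k < m \<Longrightarrow> b k \<in> complex_kernel A" and "f \<in> Q_hat A v N"
  shows "Phi m b f \<in> P_s A m b v N"
proof -
  have P: "P_hat A v N \<subseteq> {f. Phi m b f \<in> P_s A m b v N}"
    unfolding P_hat_def
  proof (rule left_ideal_gen_least)
    show "{t_mon (I \<union> J - \<Inter> N) |I J. I \<in> N \<and> J \<in> family_compl A v N}
        \<subseteq> {f. Phi m b f \<in> P_s A m b v N}"
      unfolding P_s_def
      by clarsimp (rule left_ideal_gen_superset, auto simp: mps_ring_one Phi_t_mon)
  qed (auto simp: P_s_def Phi.subst_zero Phi.subst_add Phi.subst_mult mps_ring_zero mps_ring_add
      mps_ring_mult Phi_in_mps_ring left_ideal_gen_zero
      intro: left_ideal_gen_add left_ideal_gen_mult)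
  \<comment> \<open>Each generator of the product has a factor in \<open>At_ideal A\<close>, whose
    image is 0.\<close>
  have AM: "ideal_prod UNIV (At_ideal A) (M_hat N) \<subseteq> {f. Phi m b f = 0}"
    unfolding ideal_prod_def
    by (rule left_ideal_gen_least)
       (auto simp: Phi.subst_zero Phi.subst_add Phi.subst_mult Phi_At_ideal[OF assms(1)])
  from assms(2) show ?thesis
    unfolding Q_hat_def ideal_sum_def using P AM by (fastforce simp: Phi.subst_add)
qed

text \<open>Squarefree monomials over disjoint sets multiply to the monomial of the union. Removing
  \<open>\<Inter>N\<close> takes nothing from \<open>J - neg_supp v 0\<close>, because it lies
  inside \<open>neg_supp v 0\<close>.\<close>

lemma t_mon_mult_m_hat:
  assumes "neg_supp v 0 \<in> N"
  shows "t_mon (J - neg_supp v 0) * m_hat v N = t_mon (neg_supp v 0 \<union> J - \<Inter>N)"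
proof -
  have "neg_supp v 0 \<union> J - \<Inter>N = (J - neg_supp v 0) \<union> (neg_supp v 0 - \<Inter>N)"
    using assms by auto
  then show ?thesis
    unfolding t_mon_def m_hat_def
    by (metis Diff_disjoint Diff_subset disjoint_iff finite prod.union_disjoint subset_iff DiffD2)
qed

theorem proposition6p4:
  fixes A :: "int^'n^'d"
    and \<beta> :: "complex^'d"
    and w :: "real^'n"
    and v0 :: "complex^'n"
    and b :: "nat \<Rightarrow> complex^'n"
    and N :: "'n set set"
    and m :: nat
  assumes rank_A: "rank (map_matrix rat_of_int A) = CARD('d)"
    and hyperplane: "cols_on_hyperplane A"
    and generic: "generic_weight A w"
    and fake_exp: "fake_exponent A \<beta> w v0"
    and m_def: "m = CARD('n) - CARD('d)"
    and basis: "is_kernel_basis A b"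
    and ordered: "ordered_neg_supp_family A w v0 N"
    and colon: "ideal_colon (mps_ring {..<m}) (P_s A m b v0 N) (m_s m b v0 N)
                  = P_s_at_zero A m b v0 N"
  shows "Phi m b ` ideal_colon UNIV (Q_hat A v0 N) (m_hat v0 N)
           = ideal_colon (mps_ring {..<m}) (P_s A m b v0 N) (m_s m b v0 N)"
proof (rule subset_antisym)
  have b: "inj_on b {..<m}" "vec.independent (b ` {..<m})" "vec.span (b ` {..<m}) = complex_kernel A"
    using basis unfolding is_kernel_basis_def m_def Let_def by auto
  have ker: "b k \<in> complex_kernel A" if "k < m" for k
    using b(3) that by (metis imageI lessThan_iff vec.span_base)
  have I0: "neg_supp v0 0 \<in> N"
    using ordered unfolding ordered_neg_supp_family_def neg_supp_family_def by simp
  have m_hat: "Phi m b (m_hat v0 N) = m_s m b v0 N"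
    by (simp add: m_hat_def m_s_def Phi_t_mon)
  show "Phi m b ` ideal_colon UNIV (Q_hat A v0 N) (m_hat v0 N)
      \<subseteq> ideal_colon (mps_ring {..<m}) (P_s A m b v0 N) (m_s m b v0 N)"
    unfolding ideal_colon_def
    using Phi_Q_hat[OF ker, where v = v0 and N = N]
    by (auto simp: Phi_in_mps_ring m_hat[symmetric] Phi.subst_mult[symmetric])
  \<comment> \<open>Lifts are sought in the colon ideal of \<open>P_hat\<close>, which is contained
    in that of \<open>Q_hat\<close>.\<close>
  let ?T = "Phi m b ` ideal_colon UNIV (P_hat A v0 N) (m_hat v0 N)"
  have P_add: "f + h \<in> P_hat A v0 N" if "f \<in> P_hat A v0 N" "h \<in> P_hat A v0 N" for f h
    using that unfolding P_hat_def by (intro left_ideal_gen_add) auto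
  have P_mult: "r * f \<in> P_hat A v0 N" if "f \<in> P_hat A v0 N" for r f
    using that unfolding P_hat_def by (intro left_ideal_gen_mult) auto
  have "P_s_at_zero A m b v0 N \<subseteq> ?T"
    unfolding P_s_at_zero_def
  proof (rule left_ideal_gen_least)
    show "0 \<in> ?T"
      by (rule image_eqI[of _ _ 0])
         (auto simp: Phi.subst_zero ideal_colon_def P_hat_def left_ideal_gen_zero)
    show "x + y \<in> ?T" if "x \<in> ?T" "y \<in> ?T" for x y
      using that P_add
      by (auto simp: ideal_colon_def Phi.subst_add[symmetric] distrib_right)
    \<comment> \<open>Surjectivity enters here: \<open>r\<close> itself must be lifted before it can
      multiply a preimage of \<open>x\<close>.\<close>
    show "r * x \<in> ?T" if "r \<in> mps_ring {..<m}" "x \<in> ?T" for r x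
    proof -
      obtain \<rho> where "Phi m b \<rho> = r"
        using Phi_surj[OF b(1,2) \<open>r \<in> mps_ring {..<m}\<close>] by blast
      then show ?thesis
        using \<open>x \<in> ?T\<close> P_mult
        by (auto simp: ideal_colon_def Phi.subst_mult[symmetric] mult.assoc)
    qed
    have "t_mon (J - neg_supp v0 0) \<in> ideal_colon UNIV (P_hat A v0 N) (m_hat v0 N)"
      if "J \<in> family_compl A v0 N" for J
      using that I0 unfolding ideal_colon_def P_hat_def
      by (auto simp: t_mon_mult_m_hat[OF I0] intro!: left_ideal_gen_superset)
    then show "{s_mon m b (J - neg_supp v0 0) |J. J \<in> family_compl A v0 N} \<subseteq> ?T"
      by (auto simp: Phi_t_mon[symmetric])
  qed
  moreover have "P_hat A v0 N \<subseteq> Q_hat A v0 N"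
    unfolding Q_hat_def ideal_prod_def by (intro subset_ideal_sum_right left_ideal_gen_zero)
  \<comment> \<open>The assumption \<open>colon\<close> replaces the left side by
    \<open>P_s_at_zero\<close>, which lies in \<open>?T\<close>.\<close>
  ultimately show "ideal_colon (mps_ring {..<m}) (P_s A m b v0 N) (m_s m b v0 N)
      \<subseteq> Phi m b ` ideal_colon UNIV (Q_hat A v0 N) (m_hat v0 N)"
    unfolding colon by (auto simp: ideal_colon_def)
qed

end
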